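(* Let $f:\mathbb{R}^n\to\mathbb{R}$ be continuously differentiable and bounded below by a constant $f_{\mathrm{low}}$, and consider a run of the trust-region algorithm described in the context. Assume there is $L\ge 1$ with $|f(x_k+s_k)-m_k(s_k)|\le \tfrac12(L+\|B_k\|)\|s_k\|^2$ for all $k\in\mathbb{N}$, and that there exist $\mu>0$ and $0\le p\le 1$ such that $\max_{j=0,\ldots,k}\|B_j\|\le \mu(1+|\mathcal{S}_{k-1}|^p)$ for all $k\in\mathbb{N}$. Assume that the algorithm generates infinitely many successful iterations and that $f(x_k)\ge f_{\mathrm{low}}$ for all $k\in\mathbb{N}$. Define $$\kappa_0:=\frac{\psi_\beta(2\mu)}{\eta_1\kappa_{\mathrm{mdc}}a_{\min}}>0,\qquad \kappa_1:=(f(x_0)-f_{\mathrm{low}})\,\kappa_0\ge 0,\qquad \kappa_2:=\frac{\psi_\beta(2\mu)}{\psi_\beta(\mu)}>0.$$ Let $\epsilon>0$, let $k_\epsilon$ be the first iteration such that $\|\nabla f(x_{k_\epsilon})\|\le\epsilon$, and let $\mathcal{S}(\epsilon):=\{k\in\mathcal{S}\mid k<k_\epsilon\}$. If $p=0$, then $|\mathcal{S}(\epsilon)|\le \kappa_1\epsilon^{-2}=O(\epsilon^{-2})$. If $0<p<1$, then $$|\mathcal{S}(\epsilon)|\le\left[(1-p)(\kappa_1\epsilon^{-2}-\kappa_2)+1\right]^{1/(1-p)}=O\left([(1-p)\epsilon^{-2}]^{1/(1-p)}\right).$$ If $p=1$, then $|\mathcal{S}(\epsilon)|\le\exp(\k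appa_1\epsilon^{-2}-\kappa_2)$.
   Context: $\|\cdot\|$ is the Euclidean norm for vectors and the induced norm for matrices; $\mathbb{N}=\{0,1,2,\ldots\}$; by convention $0^0=1$; $|\mathcal A|$ is the cardinality of a finite set. Trust-region algorithm. Fix constants $0<\eta_1\le\eta_2<1$, $0<\gamma_1\le\gamma_2<1\le\gamma_3\le\gamma_4$, $0<\kappa_{\mathrm{mdc}}\le\frac12$, $-1\le\alpha\le1$, $0\le\beta\le1$, $x_0\in\mathbb{R}^n$, $\Delta_0>0$. For $k=0,1,\ldots$: choose a symmetric $B_k\in\mathbb{R}^{n\times n}$ and set $m_k(s):=f(x_k)+\nabla f(x_k)^Ts+\frac12 s^TB_ks$ and $r_k:=\frac{\|\nabla f(x_k)\|^\alpha}{(1+\|B_k\|)^\beta}\Delta_k$. Let $s_{k,\mathrm{cp}}:=-t_k\nabla f(x_k)$, where $t_k$ minimizes $m_k(-t\nabla f(x_k))$ over $t\ge0$ with $\|t\nabla f(x_k)\|\le r_k$. Compute any $s_k$ with $\|s_k\|\le r_k$ and $m_k(0)-m_k(s_k)\ge2\kappa_{\mathrm{mdc}}(m_k(0)-m_k(s_{k,\mathrm{cp}}))$. Let $\rho_k:=\frac{f(x_k)-f(x_k+s_k)}{m_k(0)-m_k(s_k)}$. If $\rho_k\ge\eta_1$, set $x_{k+1}:=x_k+s_k$; otherwise $x_{k+1}:=x_k$. Choose $\Delta_{k+1}\in[\gamma_3\Delta_k,\gamma_4\Delta_k]$ if $\rho_k\ge\eta_2$; $\Delta_{k+1}\in[\gamma_2\Delta_k,\Delta_k]$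 if $\eta_1\le\rho_k<\eta_2$; $\Delta_{k+1}\in[\gamma_1\Delta_k,\gamma_2\Delta_k]$ if $\rho_k<\eta_1$. Iteration $i$ is successful if $\rho_i\ge\eta_1$; $\mathcal{S}:=\{i\in\mathbb{N}\mid\rho_i\ge\eta_1\}$, $\mathcal{S}_k:=\{i\in\mathcal{S}\mid i\le k\}$, and $|\mathcal{S}_{-1}|:=0$. $a_{\min}:=2\gamma_1\kappa_{\mathrm{mdc}}(1-\eta_2)\min\left\{1,\frac{\Delta_0}{\|\nabla f(x_0)\|^{1-\alpha}}\right\}$. For $x\ge0$, $\psi_\beta(x):=L+x$ if $\beta\in[0,1/L]$ and $\psi_\beta(x):=L(1+x)$ if $\beta\in(1/L,1]$. The $O(\cdot)$ notation refers to $\epsilon\to0$. *)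

theory Defs
  imports "HOL-Analysis.Analysis" "HOL-Library.Landau_Symbols"
begin

text \<open>Real powers with the convention \<open>0\<^sup>0 = 1\<close>; the library's \<open>0 powr 0\<close> is \<open>0\<close>.\<close>

definition rpow :: "real \<Rightarrow> real \<Rightarrow> real" where
  "rpow x a = (if a = 0 then 1 else x powr a)"

text \<open>The matrix norm induced by the Euclidean norm. (The library's \<open>norm\<close> on the matrix type
  is the Frobenius norm.)\<close>

definition matnorm :: "real^'n^'n \<Rightarrow> real" where
  "matnorm B = onorm (\<lambda>v. B *v v)"

text \<open>Throughout, \<open>g\<close> is the gradient of \<open>f\<close>.\<close>

definition tr_model ::
    "(real^'n \<Rightarrow> real) \<Rightarrow> (real^'n \<Rightarrow> real^'n) \<Rightarrow> real^'n \<Rightarrow> real^'n^'n \<Rightarrow> real^'n \<Rightarrow> real" where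
  "tr_model f g x B s = f x + g x \<bullet> s + 1/2 * (s \<bullet> (B *v s))"

definition tr_radius ::
    "real \<Rightarrow> real \<Rightarrow> (real^'n \<Rightarrow> real^'n) \<Rightarrow> real^'n \<Rightarrow> real^'n^'n \<Rightarrow> real \<Rightarrow> real" where
  "tr_radius \<alpha> \<beta> g x B \<Delta> = rpow (norm (g x)) \<alpha> / rpow (1 + matnorm B) \<beta> * \<Delta>"

definition tr_ratio ::
    "(real^'n \<Rightarrow> real) \<Rightarrow> (real^'n \<Rightarrow> real^'n) \<Rightarrow> real^'n \<Rightarrow> real^'n^'n \<Rightarrow> real^'n \<Rightarrow> real" where
  "tr_ratio f g x B s = (f x - f (x + s)) / (tr_model f g x B 0 - tr_model f g x B s)"

text \<open>\<open>t\<close> is a Cauchy step length, so that \<open>- t *\<^sub>R g x\<close> is the Cauchy step within radius \<open>r\<close>.\<close>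

definition is_cauchy_length ::
    "(real^'n \<Rightarrow> real) \<Rightarrow> (real^'n \<Rightarrow> real^'n) \<Rightarrow> real^'n \<Rightarrow> real^'n^'n \<Rightarrow> real \<Rightarrow> real \<Rightarrow> bool" where
  "is_cauchy_length f g x B r t \<longleftrightarrow>
     is_arg_min (\<lambda>t. tr_model f g x B (- t *\<^sub>R g x)) (\<lambda>t. 0 \<le> t \<and> norm (t *\<^sub>R g x) \<le> r) t"

locale trust_region_run =
  fixes f :: "real^'n \<Rightarrow> real" and g :: "real^'n \<Rightarrow> real^'n"
    and \<eta>\<^sub>1 \<eta>\<^sub>2 \<gamma>\<^sub>1 \<gamma>\<^sub>2 \<gamma>\<^sub>3 \<gamma>\<^sub>4 \<kappa>\<^sub>m\<^sub>d\<^sub>c \<alpha> \<beta> :: real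
    and x s :: "nat \<Rightarrow> real^'n" and B :: "nat \<Rightarrow> real^'n^'n" and \<Delta> t :: "nat \<Rightarrow> real"
  assumes eta: "0 < \<eta>\<^sub>1" "\<eta>\<^sub>1 \<le> \<eta>\<^sub>2" "\<eta>\<^sub>2 < 1"
    and gamma: "0 < \<gamma>\<^sub>1" "\<gamma>\<^sub>1 \<le> \<gamma>\<^sub>2" "\<gamma>\<^sub>2 < 1" "1 \<le> \<gamma>\<^sub>3" "\<gamma>\<^sub>3 \<le> \<gamma>\<^sub>4"
    and kappa_mdc: "0 < \<kappa>\<^sub>m\<^sub>d\<^sub>c" "\<kappa>\<^sub>m\<^sub>d\<^sub>c \<le> 1/2"
    and alpha: "-1 \<le> \<alpha>" "\<alpha> \<le> 1"
    and beta: "0 \<le> \<beta>" "\<beta> \<le> 1"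
    and Delta_0: "0 < \<Delta> 0"
    and B_symmetric: "transpose (B k) = B k"
    and cauchy_length:
      "is_cauchy_length f g (x k) (B k) (tr_radius \<alpha> \<beta> g (x k) (B k) (\<Delta> k)) (t k)"
    and step_bound: "norm (s k) \<le> tr_radius \<alpha> \<beta> g (x k) (B k) (\<Delta> k)"
    and step_decrease:
      "tr_model f g (x k) (B k) 0 - tr_model f g (x k) (B k) (s k)
         \<ge> 2 * \<kappa>\<^sub>m\<^sub>d\<^sub>c * (tr_model f g (x k) (B k) 0 - tr_model f g (x k) (B k) (- t k *\<^sub>R g (x k)))"
    and iterate_Suc:
      "x (Suc k) = (if tr_ratio f g (x k) (B k) (s k) \<ge> \<eta>\<^sub>1 then x k + s k else x k)"
    and Delta_very_successful:
      "tr_ratio f g (x k) (B k) (s k) \<ge> \<eta>\<^sub>2 \<Longrightarrow> \<Delta> (Suc k) \<in> {\<gamma>\<^sub>3 * \<Delta> k..\<gamma>\<^sub>4 * \<Delta> k}"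
    and Delta_successful:
      "\<eta>\<^sub>1 \<le> tr_ratio f g (x k) (B k) (s k) \<Longrightarrow> tr_ratio f g (x k) (B k) (s k) < \<eta>\<^sub>2
         \<Longrightarrow> \<Delta> (Suc k) \<in> {\<gamma>\<^sub>2 * \<Delta> k..\<Delta> k}"
    and Delta_unsuccessful:
      "tr_ratio f g (x k) (B k) (s k) < \<eta>\<^sub>1 \<Longrightarrow> \<Delta> (Suc k) \<in> {\<gamma>\<^sub>1 * \<Delta> k..\<gamma>\<^sub>2 * \<Delta> k}"

definition successful ::
    "(real^'n \<Rightarrow> real) \<Rightarrow> (real^'n \<Rightarrow> real^'n) \<Rightarrow> real \<Rightarrow> (nat \<Rightarrow> real^'n) \<Rightarrow> (nat \<Rightarrow> real^'n)
       \<Rightarrow> (nat \<Rightarrow> real^'n^'n) \<Rightarrow> nat set" where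
  "successful f g \<eta>\<^sub>1 x s B = {k. tr_ratio f g (x k) (B k) (s k) \<ge> \<eta>\<^sub>1}"

text \<open>Meaningful only when some iterate has gradient norm at most \<open>\<epsilon>\<close>.\<close>

definition first_iter :: "(real^'n \<Rightarrow> real^'n) \<Rightarrow> (nat \<Rightarrow> real^'n) \<Rightarrow> real \<Rightarrow> nat" where
  "first_iter g x \<epsilon> = (LEAST k. norm (g (x k)) \<le> \<epsilon>)"

definition successful_before ::
    "(real^'n \<Rightarrow> real) \<Rightarrow> (real^'n \<Rightarrow> real^'n) \<Rightarrow> real \<Rightarrow> (nat \<Rightarrow> real^'n) \<Rightarrow> (nat \<Rightarrow> real^'n)
       \<Rightarrow> (nat \<Rightarrow> real^'n^'n) \<Rightarrow> real \<Rightarrow> nat set" where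
  "successful_before f g \<eta>\<^sub>1 x s B \<epsilon> = {k \<in> successful f g \<eta>\<^sub>1 x s B. k < first_iter g x \<epsilon>}"

text \<open>Here \<open>\<Delta>\<^sub>0\<close> is the initial radius and \<open>\<nu>\<close> the norm of the initial gradient. If the denominator
  vanishes, the quotient is read as \<open>+\<infinity>\<close> (not as the library's \<open>0\<close>), so the minimum is \<open>1\<close>.\<close>

definition a_min :: "real \<Rightarrow> real \<Rightarrow> real \<Rightarrow> real \<Rightarrow> real \<Rightarrow> real \<Rightarrow> real" where
  "a_min \<gamma>\<^sub>1 \<kappa>\<^sub>m\<^sub>d\<^sub>c \<eta>\<^sub>2 \<alpha> \<Delta>\<^sub>0 \<nu> = 2 * \<gamma>\<^sub>1 * \<kappa>\<^sub>m\<^sub>d\<^sub>c * (1 - \<eta>\<^sub>2) *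
     (if rpow \<nu> (1 - \<alpha>) = 0 then 1 else min 1 (\<Delta>\<^sub>0 / rpow \<nu> (1 - \<alpha>)))"

definition psi :: "real \<Rightarrow> real \<Rightarrow> real \<Rightarrow> real" where
  "psi \<beta> L y = (if \<beta> \<le> 1 / L then L + y else L * (1 + y))"

end

theory Submission
  imports Defs "HOL-Real_Asymp.Real_Asymp"
begin

text \<open>Write \<open>\<psi>\<close> for \<open>psi \<beta> L\<close>. The argument is an accounting of the objective: every successful
  iteration before the gradient norm drops to \<open>\<epsilon>\<close> buys a decrease of \<open>f\<close> that is of order \<open>\<epsilon>\<^sup>2\<close> divided
  by the size of the model Hessians so far, and the total decrease is at most \<open>f (x 0) - f\<^sub>l\<^sub>o\<^sub>w\<close>.

  The Cauchy step decreases the model by about \<open>norm (g (x k))\<close> times the radius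
  (\<open>cauchy_decrease\<close>), whereas the model error is quadratic in the radius. A small radius therefore
  makes the iteration very successful (\<open>very_successful_if_radius_small\<close>), after which \<open>\<Delta>\<close> does not
  shrink. So, unless it is that small from the start, \<open>\<Delta>\<close> never falls more than one factor \<open>\<gamma>\<^sub>1\<close> below the
  threshold; the minimum in \<open>a_min\<close> accounts for a small \<open>\<Delta> 0\<close>. If \<open>M\<close> bounds
  the Hessians and \<open>\<epsilon>\<close> bounds the gradients up to \<open>k\<close> from below, then \<open>\<Delta> k\<close> is
  at least \<open>a_min * \<epsilon> powr (1 - \<alpha>) * (1 + M) powr \<beta> / \<psi> M\<close> (\<open>Delta_ge\<close>). The function \<open>\<psi>\<close> enters because the
  threshold for one Hessian norm \<open>y\<close> is proportional to \<open>(1 + y) powr \<beta> / (L + y)\<close>, which is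
  decreasing in \<open>y \<ge> 0\<close> only for \<open>\<beta> \<le> 1 / L\<close>; for larger \<open>\<beta>\<close> the denominator is enlarged to
  \<open>L * (1 + y)\<close> (\<open>psi_quotient_bound\<close>). In the product of gradient norm and radius all powers of
  \<open>\<alpha>\<close> and \<open>\<beta>\<close> cancel, and a successful iteration decreases \<open>f\<close> by at least
  \<open>\<eta>\<^sub>1 * \<kappa>\<^sub>m\<^sub>d\<^sub>c * a_min * \<epsilon>\<^sup>2 / \<psi> M\<close> (\<open>successful_decrease_ge\<close>).

  At the success that is preceded by \<open>j\<close> others one may take \<open>M = \<mu> * (1 + j\<^sup>p)\<close>. Summing over the
  successes gives \<open>(\<Sum>j<n. \<psi> (2 * \<mu>) / \<psi> (\<mu> * (1 + j\<^sup>p))) \<le> \<kappa>\<^sub>1 / \<epsilon>\<^sup>2\<close>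
  for their number \<open>n\<close> (\<open>hessian_sum_successes_le\<close>). For \<open>p = 0\<close> the left side is \<open>n\<close>; for \<open>p > 0\<close>
  its first term is \<open>\<kappa>\<^sub>2\<close> and the others are at least \<open>1 / j\<^sup>p\<close>, so it grows like the integral
  of \<open>1 / y\<^sup>p\<close>, that is \<open>(n powr (1 - p) - 1) / (1 - p)\<close> or \<open>ln n\<close>. Solving for \<open>n\<close> gives
  the bounds. As they hold for every initial stretch of iterations with gradients above \<open>\<epsilon>\<close>, infinitely
  many successes force the gradient norm below every \<open>\<epsilon>\<close>.\<close>

section \<open>Real inequalities\<close>

lemma rpow_pos_eq: "y > 0 \<Longrightarrow> rpow y a = y powr a"
  by (simp add: rpow_def)

text \<open>Weighted arithmetic-geometric mean inequality for \<open>u\<close> and \<open>1\<close>. It is used twice: for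
  the monotonicity of \<open>(1 + y) powr \<beta> / (L + y)\<close> and for comparing a sum of inverse powers with its
  integral.\<close>

lemma bernoulli_powr:
  fixes u b :: real
  assumes "u > 0" "0 \<le> b" "b \<le> 1"
  shows "u powr b \<le> 1 + b * (u - 1)"
  using Youngs_inequality_0[of b "1 - b" u 1] assms by (simp add: algebra_simps)

lemma psi_ge: "\<lbrakk>L \<ge> 1; y \<ge> 0\<rbrakk> \<Longrightarrow> L + y \<le> psi \<beta> L y"
  using mult_right_mono[of 1 L y] by (simp add: psi_def algebra_simps)

lemma psi_pos: "\<lbrakk>L \<ge> 1; y \<ge> 0\<rbrakk> \<Longrightarrow> 0 < psi \<beta> L y"
  using psi_ge[of L y \<beta>] by linarith

lemma psi_mono: "\<lbrakk>L \<ge> 1; y \<le> z\<rbrakk> \<Longrightarrow> psi \<beta> L y \<le> psi \<beta> L z"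
  by (simp add: psi_def mult_left_mono)

text \<open>This lets the Hessian bound after \<open>j \<ge> 1\<close> successes be expressed by the one at \<open>j = 1\<close>: the
  terms of \<open>\<psi>\<close> that do not grow with \<open>q = j\<^sup>p\<close> are simply multiplied by \<open>q \<ge> 1\<close>.\<close>

lemma psi_scale:
  assumes "L \<ge> 1" "\<mu> > 0" "q \<ge> 1"
  shows "psi \<beta> L (\<mu> * (1 + q)) \<le> q * psi \<beta> L (2 * \<mu>)"
proof -
  have "L + \<mu> * 1 \<le> q * (L + \<mu>)"
    using mult_right_mono[of 1 q "L + \<mu>"] assms by simp
  moreover have "L * (1 + \<mu>) \<le> q * (L * (1 + \<mu>))"
    using mult_right_mono[of 1 q "L * (1 + \<mu>)"] assms by simp
  ultimately show ?thesis by (simp add: psi_def algebra_simps)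
qed

text \<open>The reason for the two cases of \<open>psi\<close>. For \<open>\<beta> * L \<le> 1\<close> the quotient
  \<open>(1 + y) powr \<beta> / (L + y)\<close> is decreasing, since its logarithmic derivative is
  \<open>\<beta> / (1 + y) - 1 / (L + y) \<le> 0\<close>. Otherwise it need not be, but it dominates
  \<open>(1 + y) powr (\<beta> - 1) / L\<close>, which is.\<close>

lemma psi_quotient_bound:
  assumes L: "L \<ge> 1" and b: "0 \<le> \<beta>" "\<beta> \<le> 1" and yz: "0 \<le> y" "y \<le> z"
  shows "(1 + z) powr \<beta> / psi \<beta> L z \<le> (1 + y) powr \<beta> / (L + y)"
proof (cases "\<beta> \<le> 1 / L")
  case True
  hence bL: "\<beta> * L \<le> 1" using L by (simp add: field_simps)
  have by_y: "\<beta> * y \<le> y" using mult_right_mono[of \<beta> 1 y] b yz by simp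
  \<comment> \<open>By Bernoulli's inequality for this \<open>u\<close> it suffices to bound \<open>\<beta> * (u - 1)\<close>.\<close>
  define u where "u = (1 + z) / (1 + y)"
  have u: "u > 0" using yz by (simp add: u_def)
  have "\<beta> * (L + y) \<le> 1 + y" using bL by_y by (simp add: algebra_simps)
  hence "\<beta> * (L + y) * (z - y) \<le> (1 + y) * (z - y)"
    by (rule mult_right_mono) (use yz in simp)
  hence "\<beta> * (u - 1) \<le> (z - y) / (L + y)"
    using L yz by (simp add: u_def field_simps)
  hence "u powr \<beta> \<le> 1 + (z - y) / (L + y)"
    using bernoulli_powr[OF u b] by linarith
  also have "\<dots> = (L + z) / (L + y)" using L yz by (simp add: field_simps)
  finally have "(1 + z) powr \<beta> / (1 + y) powr \<beta> \<le> (L + z) / (L + y)"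
    using yz by (simp add: u_def powr_divide)
  moreover have "(1 + y) powr \<beta> > 0" using yz by simp
  ultimately show ?thesis using True L yz by (simp add: psi_def field_simps)
next
  case False
  have "(1 + z) powr \<beta> / psi \<beta> L z = (1 + z) powr (\<beta> - 1) / L"
    using False yz by (simp add: psi_def powr_diff)
  also have "\<dots> \<le> (1 + y) powr (\<beta> - 1) / L"
    using L b yz by (intro divide_right_mono powr_mono2') auto
  also have "\<dots> = (1 + y) powr \<beta> / (L * (1 + y))"
    using yz by (simp add: powr_diff)
  also have "\<dots> \<le> (1 + y) powr \<beta> / (L + y)"
  proof (rule divide_left_mono)
    show "L + y \<le> L * (1 + y)"
      using mult_right_mono[of 1 L y] L yz by (simp add: algebra_simps)
    show "0 < L * (1 + y) * (L + y)" using L yz by simp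
  qed simp
  finally show ?thesis .
qed

text \<open>The left side is the integral of \<open>1 / y powr p\<close> from \<open>1\<close> to \<open>n\<close>. Its growth over one unit
  step is bounded by Bernoulli's inequality, which replaces integration.\<close>

lemma sum_inverse_powr_ge:
  fixes p :: real
  assumes "0 < p" "p < 1" "n \<ge> 1"
  shows "(real n powr (1 - p) - 1) / (1 - p) \<le> (\<Sum>j = 1..<n. 1 / real j powr p)"
  using assms(3)
proof (induction n rule: dec_induct)
  case base
  show ?case by simp
next
  case (step n)
  have n: "real n > 0" using step by simp
  have "(real (Suc n) / real n) powr (1 - p) \<le> 1 + (1 - p) * (real (Suc n) / real n - 1)"
    by (rule bernoulli_powr) (use assms n in auto)
  also have "\<dots> = 1 + (1 - p) / real n" using n by (simp add: field_simps)
  finally have "real (Suc n) powr (1 - p) \<le> (1 + (1 - p) / real n) * real n powr (1 - p)"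
    using n by (simp add: powr_divide pos_divide_le_eq)
  also have "\<dots> = real n powr (1 - p) + (1 - p) / real n powr p"
    using n by (simp add: powr_diff field_simps)
  finally have "real (Suc n) powr (1 - p) - 1 \<le> (real n powr (1 - p) - 1) + (1 - p) / real n powr p"
    by simp
  hence "(real (Suc n) powr (1 - p) - 1) / (1 - p)
      \<le> ((real n powr (1 - p) - 1) + (1 - p) / real n powr p) / (1 - p)"
    using assms by (intro divide_right_mono) auto
  also have "\<dots> = (real n powr (1 - p) - 1) / (1 - p) + 1 / real n powr p"
    using assms by (simp add: add_divide_distrib)
  finally show ?case using step by simp
qed

lemma sum_inverse_ge_ln:
  assumes "n \<ge> 1"
  shows "ln (real n) \<le> (\<Sum>j = 1..<n. 1 / real j)"
  using assms
proof (induction n rule: dec_induct)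
  case base
  show ?case by simp
next
  case (step n)
  have n: "real n > 0" using step by simp
  have "ln (real (Suc n)) - ln (real n) = ln (1 + 1 / real n)"
    using n ln_div[of "real (Suc n)" "real n"] by (simp add: add_divide_distrib add.commute)
  also have "\<dots> \<le> 1 / real n" using n by (intro ln_add_one_self_le_self) simp
  finally show ?case using step by simp
qed

text \<open>The objective decrease that the first \<open>n\<close> successes guarantee, up to a factor: after \<open>j\<close> successes
  the Hessians are bounded by \<open>\<mu> * (1 + j\<^sup>p)\<close>, and the decrease is inversely proportional to \<open>psi\<close>
  of that bound. The numerator normalises the term for \<open>j = 1\<close> to \<open>1\<close>.\<close>

definition hessian_sum :: "real \<Rightarrow> real \<Rightarrow> real \<Rightarrow> real \<Rightarrow> nat \<Rightarrow> real" where
  "hessian_sum \<beta> L \<mu> p n = (\<Sum>j<n. psi \<beta> L (2 * \<mu>) / psi \<beta> L (\<mu> * (1 + rpow (real j) p)))"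

lemma hessian_sum_0:
  assumes "L \<ge> 1" "\<mu> > 0"
  shows "hessian_sum \<beta> L \<mu> 0 n = real n"
  using psi_pos[of L "2 * \<mu>" \<beta>] assms
  by (simp add: hessian_sum_def rpow_def mult.commute)

text \<open>The term for \<open>j = 0\<close> is split off because there \<open>j\<^sup>p\<close> is \<open>0\<close>, where \<open>psi_scale\<close>
  fails; it is the source of \<open>\<kappa>\<^sub>2\<close>.\<close>

lemma hessian_sum_ge:
  assumes L: "L \<ge> 1" and mu: "\<mu> > 0" and p: "p > 0" and n: "n \<ge> 1"
  shows "psi \<beta> L (2 * \<mu>) / psi \<beta> L \<mu> + (\<Sum>j = 1..<n. 1 / real j powr p)
           \<le> hessian_sum \<beta> L \<mu> p n"
proof -
  define c where "c = psi \<beta> L (2 * \<mu>)"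
  have c: "c > 0" unfolding c_def using L mu by (intro psi_pos) auto
  have term_le: "1 / real j powr p \<le> c / psi \<beta> L (\<mu> * (1 + rpow (real j) p))" if "j \<ge> 1" for j
  proof -
    have q: "real j powr p \<ge> 1" using that p by (simp add: ge_one_powr_ge_zero)
    have "psi \<beta> L (\<mu> * (1 + real j powr p)) \<le> real j powr p * c"
      unfolding c_def by (rule psi_scale[OF L mu q])
    moreover have "psi \<beta> L (\<mu> * (1 + real j powr p)) > 0"
      using L mu q by (intro psi_pos) auto
    moreover have "real j powr p > 0" using q by linarith
    ultimately show ?thesis using p by (simp add: rpow_def pos_divide_le_eq pos_le_divide_eq mult.commute)
  qed
  have "{..<n} = insert 0 {1..<n}" using n by auto
  hence "hessian_sum \<beta> L \<mu> p n
      = c / psi \<beta> L \<mu> + (\<Sum>j = 1..<n. c / psi \<beta> L (\<mu> * (1 + rpow (real j) p)))"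
    using p by (simp add: hessian_sum_def c_def rpow_def)
  moreover have "(\<Sum>j = 1..<n. 1 / real j powr p)
      \<le> (\<Sum>j = 1..<n. c / psi \<beta> L (\<mu> * (1 + rpow (real j) p)))"
    by (intro sum_mono term_le) simp
  ultimately show ?thesis unfolding c_def by linarith
qed

lemma count_bound_powr:
  assumes L: "L \<ge> 1" and mu: "\<mu> > 0" and p: "0 < p" "p < 1"
    and le: "hessian_sum \<beta> L \<mu> p n \<le> K"
  shows "real n \<le> ((1 - p) * (K - psi \<beta> L (2 * \<mu>) / psi \<beta> L \<mu>) + 1) powr (1 / (1 - p))"
proof (cases "n \<ge> 1")
  case True
  define \<kappa> where "\<kappa> = psi \<beta> L (2 * \<mu>) / psi \<beta> L \<mu>"
  have "(real n powr (1 - p) - 1) / (1 - p) \<le> K - \<kappa>"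
    using sum_inverse_powr_ge[OF p True] hessian_sum_ge[OF L mu p(1) True] le
    unfolding \<kappa>_def by (smt (verit))
  hence "real n powr (1 - p) \<le> (1 - p) * (K - \<kappa>) + 1"
    using p by (simp add: field_simps)
  hence "(real n powr (1 - p)) powr (1 / (1 - p)) \<le> ((1 - p) * (K - \<kappa>) + 1) powr (1 / (1 - p))"
    using p by (intro powr_mono2) auto
  thus ?thesis using p True by (simp add: powr_powr \<kappa>_def)
qed (auto simp: not_le)

lemma count_bound_exp:
  assumes L: "L \<ge> 1" and mu: "\<mu> > 0" and le: "hessian_sum \<beta> L \<mu> 1 n \<le> K"
  shows "real n \<le> exp (K - psi \<beta> L (2 * \<mu>) / psi \<beta> L \<mu>)"
proof (cases "n \<ge> 1")
  case True
  have "ln (real n) \<le> K - psi \<beta> L (2 * \<mu>) / psi \<beta> L \<mu>"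
    using sum_inverse_ge_ln[OF True] hessian_sum_ge[OF L mu _ True, of 1 \<beta>] le by simp
  thus ?thesis using True by (metis exp_ge_zero exp_ln exp_le_cancel_iff of_nat_0_less_iff less_eq_Suc_le One_nat_def)
qed (auto simp: not_le)

text \<open>For \<open>K = 0\<close> the left side is a constant, possibly a power with negative base; it is then
  bounded by the right side, which tends to infinity.\<close>

lemma powr_bound_bigo:
  fixes K c q d :: real
  assumes K: "K \<ge> 0" and d: "d > 0" and q: "q > 0"
  shows "(\<lambda>\<epsilon>. (d * (K / \<epsilon>\<^sup>2 - c) + 1) powr q) \<in> O[at_right 0](\<lambda>\<epsilon>. (d * (1 / \<epsilon>\<^sup>2)) powr q)"
proof (cases "K = 0")
  case True
  have "(\<lambda>_. C) \<in> O[at_right 0](\<lambda>\<epsilon>. (d * (1 / \<epsilon>\<^sup>2)) powr q)" for C :: real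
    using d q by real_asymp
  thus ?thesis using True by simp
next
  case False
  with K have "K > 0" by simp
  thus ?thesis using d q by real_asymp
qed

section \<open>The Cauchy decrease\<close>

lemma matnorm_nonneg: "0 \<le> matnorm (B :: real^'n^'n)"
  unfolding matnorm_def by (intro onorm_pos_le matrix_vector_mul_bounded_linear)

lemma quadratic_form_le:
  fixes B :: "real^'n^'n"
  shows "v \<bullet> (B *v v) \<le> matnorm B * (norm v)\<^sup>2"
proof -
  have "norm (B *v v) \<le> matnorm B * norm v"
    unfolding matnorm_def by (intro onorm matrix_vector_mul_bounded_linear)
  hence "norm v * norm (B *v v) \<le> norm v * (matnorm B * norm v)"
    by (intro mult_left_mono) auto
  thus ?thesis using norm_cauchy_schwarz[of v "B *v v"]
    by (simp add: power2_eq_square algebra_simps)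
qed

text \<open>Compare the Cauchy length with the explicit length \<open>min (r / norm (g x)) (1 / M)\<close>. As it is
  at most \<open>1 / M\<close>, the quadratic term costs at most half of the linear decrease.\<close>

lemma cauchy_decrease:
  fixes B :: "real^'n^'n"
  assumes t: "is_cauchy_length f g x B r t" and r: "r \<ge> 0"
    and M: "matnorm B \<le> M" "M > 0"
  shows "1/2 * norm (g x) * min r (norm (g x) / M)
           \<le> tr_model f g x B 0 - tr_model f g x B (- t *\<^sub>R g x)"
proof -
  define \<nu> where "\<nu> = norm (g x)"
  show ?thesis
  proof (cases "\<nu> = 0")
    case True
    thus ?thesis by (simp add: \<nu>_def tr_model_def)
  next
    case False
    hence \<nu>: "\<nu> > 0" by (simp add: \<nu>_def)
    define \<tau> where "\<tau> = min (r / \<nu>) (1 / M)"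
    have \<tau>: "\<tau> \<ge> 0" "\<tau> * \<nu> \<le> r" "\<tau> * M \<le> 1"
      using r M \<nu> by (auto simp: \<tau>_def min_def field_simps)
    have "norm (\<tau> *\<^sub>R g x) \<le> r" using \<tau> by (simp add: \<nu>_def)
    hence "tr_model f g x B (- t *\<^sub>R g x) \<le> tr_model f g x B (- \<tau> *\<^sub>R g x)"
      using t \<tau> unfolding is_cauchy_length_def is_arg_min_def by (meson not_less)
    moreover have "tr_model f g x B 0 - tr_model f g x B (- \<tau> *\<^sub>R g x)
        = \<tau> * \<nu>\<^sup>2 - 1/2 * \<tau>\<^sup>2 * (g x \<bullet> (B *v g x))"
      by (simp add: tr_model_def \<nu>_def dot_square_norm power2_eq_square
          matrix_vector_mult_scaleR scaleR_matrix_vector_assoc[symmetric] vector_scaleR_matrix_ac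
          matrix_vector_mult_diff_distrib linear_neg)
    moreover have "\<tau>\<^sup>2 * (g x \<bullet> (B *v g x)) \<le> \<tau> * \<nu>\<^sup>2"
    proof -
      have "g x \<bullet> (B *v g x) \<le> M * \<nu>\<^sup>2"
        using quadratic_form_le[of "g x" B] mult_right_mono[OF M(1), of "\<nu>\<^sup>2"]
        unfolding \<nu>_def by simp
      hence "\<tau>\<^sup>2 * (g x \<bullet> (B *v g x)) \<le> \<tau>\<^sup>2 * (M * \<nu>\<^sup>2)" by (intro mult_left_mono) auto
      also have "\<dots> = (\<tau> * M) * (\<tau> * \<nu>\<^sup>2)" by (simp add: power2_eq_square)
      also have "\<dots> \<le> 1 * (\<tau> * \<nu>\<^sup>2)" by (intro mult_right_mono) (use \<tau> in auto)
      finally show ?thesis by simp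
    qed
    moreover have "1/2 * \<nu> * min r (\<nu> / M) = 1/2 * (\<tau> * \<nu>\<^sup>2)"
      using \<nu> M r by (auto simp: \<tau>_def min_def power2_eq_square field_simps)
    ultimately show ?thesis unfolding \<nu>_def by linarith
  qed
qed

section \<open>Runs with an accurate model\<close>

text \<open>The model error is required only at the computed steps, which is all that the acceptance test
  sees.\<close>

locale accurate_trust_region_run = trust_region_run +
  fixes L :: real
  assumes L_ge_1: "L \<ge> 1"
    and model_error: "\<bar>f (x k + s k) - tr_model f g (x k) (B k) (s k)\<bar>
                         \<le> 1/2 * (L + matnorm (B k)) * (norm (s k))\<^sup>2"
begin

abbreviation radius :: "nat \<Rightarrow> real" where
  "radius k \<equiv> tr_radius \<alpha> \<beta> g (x k) (B k) (\<Delta> k)"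

abbreviation ratio :: "nat \<Rightarrow> real" where
  "ratio k \<equiv> tr_ratio f g (x k) (B k) (s k)"

abbreviation model_decrease :: "nat \<Rightarrow> real" where
  "model_decrease k \<equiv> tr_model f g (x k) (B k) 0 - tr_model f g (x k) (B k) (s k)"

abbreviation amin :: real where
  "amin \<equiv> a_min \<gamma>\<^sub>1 \<kappa>\<^sub>m\<^sub>d\<^sub>c \<eta>\<^sub>2 \<alpha> (\<Delta> 0) (norm (g (x 0)))"

lemma Delta_Suc_ge: "\<Delta> k > 0 \<Longrightarrow> \<Delta> (Suc k) \<ge> \<gamma>\<^sub>1 * \<Delta> k"
  and Delta_Suc_ge_very_successful: "\<lbrakk>\<Delta> k > 0; ratio k \<ge> \<eta>\<^sub>2\<rbrakk> \<Longrightarrow> \<Delta> (Suc k) \<ge> \<Delta> k"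
proof -
  assume pos: "\<Delta> k > 0"
  have g: "\<gamma>\<^sub>1 * \<Delta> k \<le> \<gamma>\<^sub>2 * \<Delta> k" "\<gamma>\<^sub>2 * \<Delta> k \<le> \<Delta> k" "\<Delta> k \<le> \<gamma>\<^sub>3 * \<Delta> k"
    using gamma pos mult_right_mono[of \<gamma>\<^sub>1 \<gamma>\<^sub>2 "\<Delta> k"] mult_right_mono[of \<gamma>\<^sub>2 1 "\<Delta> k"]
      mult_right_mono[of 1 \<gamma>\<^sub>3 "\<Delta> k"] by auto
  show "\<Delta> (Suc k) \<ge> \<gamma>\<^sub>1 * \<Delta> k"
    using Delta_very_successful[of k] Delta_successful[of k] Delta_unsuccessful[of k] g
    by (cases "ratio k \<ge> \<eta>\<^sub>2"; cases "ratio k \<ge> \<eta>\<^sub>1") auto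
  show "\<Delta> (Suc k) \<ge> \<Delta> k" if "ratio k \<ge> \<eta>\<^sub>2"
    using Delta_very_successful[OF that] g by auto
qed

lemma Delta_pos: "\<Delta> k > 0"
proof (induction k)
  case 0
  show ?case by (rule Delta_0)
next
  case (Suc k)
  thus ?case using Delta_Suc_ge[OF Suc] gamma(1) by (smt (verit) mult_pos_pos)
qed

lemma radius_eq:
  assumes "g (x k) \<noteq> 0"
  shows "radius k = norm (g (x k)) powr \<alpha> / (1 + matnorm (B k)) powr \<beta> * \<Delta> k"
proof -
  have "1 + matnorm (B k) > 0" using matnorm_nonneg[of "B k"] by linarith
  thus ?thesis using assms by (simp add: tr_radius_def rpow_pos_eq)
qed

text \<open>The Hessian norm is replaced by \<open>L + matnorm (B k)\<close>, the constant of the model error, so that both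
  the radius test and the decrease are stated with one denominator (which is positive even for a zero
  Hessian).\<close>

lemma model_decrease_ge:
  "\<kappa>\<^sub>m\<^sub>d\<^sub>c * norm (g (x k)) * min (radius k) (norm (g (x k)) / (L + matnorm (B k)))
     \<le> model_decrease k"
proof -
  have "radius k \<ge> 0" using step_bound[of k] norm_ge_zero order_trans by blast
  from cauchy_decrease[OF cauchy_length this, of "L + matnorm (B k)"]
  have "1/2 * norm (g (x k)) * min (radius k) (norm (g (x k)) / (L + matnorm (B k)))
     \<le> tr_model f g (x k) (B k) 0 - tr_model f g (x k) (B k) (- t k *\<^sub>R g (x k))"
    using L_ge_1 matnorm_nonneg[of "B k"] by simp
  hence "2 * \<kappa>\<^sub>m\<^sub>d\<^sub>c * (1/2 * norm (g (x k)) * min (radius k) (norm (g (x k)) / (L + matnorm (B k))))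
     \<le> 2 * \<kappa>\<^sub>m\<^sub>d\<^sub>c * (tr_model f g (x k) (B k) 0 - tr_model f g (x k) (B k) (- t k *\<^sub>R g (x k)))"
    by (intro mult_left_mono) (use kappa_mdc in auto)
  also have "\<dots> \<le> model_decrease k" by (rule step_decrease)
  finally show ?thesis by (simp add: mult.assoc)
qed

text \<open>With a radius \<open>r\<close> this small, the guaranteed model decrease is \<open>\<kappa>\<^sub>m\<^sub>d\<^sub>c * norm (g (x k)) * r\<close>, linear
  in \<open>r\<close>, and the model error is at most \<open>(L + matnorm (B k)) * r\<^sup>2 / 2\<close>; the factor in the
  hypothesis is chosen such that the error is at most \<open>1 - \<eta>\<^sub>2\<close> times the decrease.\<close>

lemma very_successful_if_radius_small:
  assumes g: "g (x k) \<noteq> 0"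
    and small: "radius k \<le> 2 * \<kappa>\<^sub>m\<^sub>d\<^sub>c * (1 - \<eta>\<^sub>2) * norm (g (x k)) / (L + matnorm (B k))"
  shows "ratio k \<ge> \<eta>\<^sub>2"
proof -
  define \<nu> M r where "\<nu> = norm (g (x k))" and "M = L + matnorm (B k)" and "r = radius k"
  have \<nu>: "\<nu> > 0" using g by (simp add: \<nu>_def)
  have M: "M > 0" using L_ge_1 matnorm_nonneg[of "B k"] by (simp add: M_def)
  have "1 + matnorm (B k) > 0" using matnorm_nonneg[of "B k"] by linarith
  hence r: "r > 0" unfolding r_def radius_eq[OF g] using g Delta_pos[of k] by simp
  have "2 * \<kappa>\<^sub>m\<^sub>d\<^sub>c * (1 - \<eta>\<^sub>2) \<le> 1 * 1"
    by (rule mult_mono) (use kappa_mdc eta in auto)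
  hence "2 * \<kappa>\<^sub>m\<^sub>d\<^sub>c * (1 - \<eta>\<^sub>2) * (\<nu> / M) \<le> 1 * (\<nu> / M)"
    by (intro mult_right_mono) (use \<nu> M in auto)
  \<comment> \<open>The radius, not the Hessian, limits the step, because \<open>2 * \<kappa>\<^sub>m\<^sub>d\<^sub>c * (1 - \<eta>\<^sub>2) \<le> 1\<close>.\<close>
  hence "min r (\<nu> / M) = r"
    using small unfolding \<nu>_def M_def r_def by simp
  hence dec: "\<kappa>\<^sub>m\<^sub>d\<^sub>c * \<nu> * r \<le> model_decrease k"
    using model_decrease_ge[of k] unfolding \<nu>_def M_def r_def by simp
  have pos: "\<kappa>\<^sub>m\<^sub>d\<^sub>c * \<nu> * r > 0" using kappa_mdc \<nu> r by simp
  have "M * r \<le> 2 * \<kappa>\<^sub>m\<^sub>d\<^sub>c * (1 - \<eta>\<^sub>2) * \<nu>"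
    using small M unfolding \<nu>_def[symmetric] M_def[symmetric] r_def[symmetric]
    by (simp add: field_simps)
  hence "M * r * r \<le> 2 * \<kappa>\<^sub>m\<^sub>d\<^sub>c * (1 - \<eta>\<^sub>2) * \<nu> * r"
    by (intro mult_right_mono) (use r in auto)
  moreover have "M * (norm (s k))\<^sup>2 \<le> M * r\<^sup>2"
    using step_bound[of k] M by (intro mult_left_mono power_mono) (auto simp: r_def)
  ultimately have err: "\<bar>f (x k + s k) - tr_model f g (x k) (B k) (s k)\<bar>
      \<le> (1 - \<eta>\<^sub>2) * (\<kappa>\<^sub>m\<^sub>d\<^sub>c * \<nu> * r)"
    using model_error[of k] unfolding M_def[symmetric] by (simp add: power2_eq_square algebra_simps)
  also have "\<dots> \<le> (1 - \<eta>\<^sub>2) * model_decrease k"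
    using dec eta by (intro mult_left_mono) auto
  finally have "f (x k + s k) - tr_model f g (x k) (B k) (s k) \<le> (1 - \<eta>\<^sub>2) * model_decrease k"
    by linarith
  moreover have "tr_model f g (x k) (B k) 0 = f (x k)" by (simp add: tr_model_def)
  ultimately have "\<eta>\<^sub>2 * model_decrease k \<le> f (x k) - f (x k + s k)"
    by (simp add: algebra_simps)
  thus ?thesis using dec pos by (simp add: tr_ratio_def pos_le_divide_eq)
qed

lemma amin_pos: "amin > 0"
proof -
  have "rpow (norm (g (x 0))) (1 - \<alpha>) = 0 \<or> rpow (norm (g (x 0))) (1 - \<alpha>) > 0"
    by (simp add: rpow_def)
  thus ?thesis using gamma kappa_mdc eta Delta_0 by (auto simp: a_min_def)
qed

lemma amin_le: "amin \<le> \<gamma>\<^sub>1 * (2 * \<kappa>\<^sub>m\<^sub>d\<^sub>c * (1 - \<eta>\<^sub>2))"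
  and amin_le_1: "amin \<le> 1"
  and amin_le_Delta_0: "g (x 0) \<noteq> 0 \<Longrightarrow> amin * norm (g (x 0)) powr (1 - \<alpha>) \<le> \<Delta> 0"
proof -
  define c where "c = \<gamma>\<^sub>1 * (2 * \<kappa>\<^sub>m\<^sub>d\<^sub>c * (1 - \<eta>\<^sub>2))"
  have "2 * \<kappa>\<^sub>m\<^sub>d\<^sub>c * (1 - \<eta>\<^sub>2) \<le> 1 * 1"
    by (rule mult_mono) (use kappa_mdc eta in auto)
  hence c: "c \<ge> 0" "c \<le> 1"
    using mult_mono[of \<gamma>\<^sub>1 1 "2 * \<kappa>\<^sub>m\<^sub>d\<^sub>c * (1 - \<eta>\<^sub>2)" 1] gamma kappa_mdc eta
    by (auto simp: c_def)
  have eq: "amin = c * (if rpow (norm (g (x 0))) (1 - \<alpha>) = 0 then 1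
      else min 1 (\<Delta> 0 / rpow (norm (g (x 0))) (1 - \<alpha>)))"
    by (simp add: a_min_def c_def mult_ac)
  show "amin \<le> \<gamma>\<^sub>1 * (2 * \<kappa>\<^sub>m\<^sub>d\<^sub>c * (1 - \<eta>\<^sub>2))"
    unfolding eq c_def[symmetric] by (intro mult_left_le) (use c in auto)
  thus "amin \<le> 1" using c by (simp add: c_def)
  assume "g (x 0) \<noteq> 0"
  hence P: "norm (g (x 0)) powr (1 - \<alpha>) > 0" and rp: "rpow (norm (g (x 0))) (1 - \<alpha>) = norm (g (x 0)) powr (1 - \<alpha>)"
    by (simp_all add: rpow_pos_eq)
  have "amin * norm (g (x 0)) powr (1 - \<alpha>)
      \<le> c * (\<Delta> 0 / norm (g (x 0)) powr (1 - \<alpha>)) * norm (g (x 0)) powr (1 - \<alpha>)"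
    unfolding eq rp using P c by (intro mult_right_mono mult_left_mono) auto
  also have "\<dots> = c * \<Delta> 0" using P by simp
  also have "\<dots> \<le> 1 * \<Delta> 0" using c Delta_0 by (intro mult_right_mono) auto
  finally show "amin * norm (g (x 0)) powr (1 - \<alpha>) \<le> \<Delta> 0" by simp
qed

text \<open>Induction over the iterations. Unless the iteration is very successful, its radius exceeds the
  threshold of \<open>very_successful_if_radius_small\<close>, and \<open>\<Delta>\<close> shrinks at most by the factor \<open>\<gamma>\<^sub>1\<close>;
  otherwise \<open>\<Delta>\<close> does not shrink and the bound is inherited. Keeping one \<open>M\<close> for all
  iterations up to \<open>k\<close> makes the bound the same number throughout.\<close>

lemma Delta_ge:
  assumes eps: "\<epsilon> > 0" and large: "\<And>j. j \<le> k \<Longrightarrow> \<epsilon> < norm (g (x j))"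
    and M: "\<And>j. j \<le> k \<Longrightarrow> matnorm (B j) \<le> M"
  shows "amin * \<epsilon> powr (1 - \<alpha>) * ((1 + M) powr \<beta> / psi \<beta> L M) \<le> \<Delta> k"
  using large M
proof (induction k)
  case 0
  have M0: "M \<ge> 0" using 0(2)[of 0] matnorm_nonneg[of "B 0"] by simp
  have g0: "norm (g (x 0)) > \<epsilon>" using 0 by simp
  have "(1 + M) powr \<beta> \<le> 1 + M" using powr_mono[of \<beta> 1 "1 + M"] beta M0 by simp
  also have "\<dots> \<le> psi \<beta> L M" using psi_ge[OF L_ge_1 M0, of \<beta>] L_ge_1 by simp
  finally have H: "(1 + M) powr \<beta> / psi \<beta> L M \<le> 1"
    using psi_pos[OF L_ge_1 M0, of \<beta>] by simp
  have "amin * \<epsilon> powr (1 - \<alpha>) * ((1 + M) powr \<beta> / psi \<beta> L M) \<le> amin * \<epsilon> powr (1 - \<alpha>) * 1"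
    by (intro mult_left_mono H) (use amin_pos in simp)
  also have "\<dots> \<le> amin * norm (g (x 0)) powr (1 - \<alpha>)"
    using amin_pos eps g0 alpha by (auto intro!: mult_left_mono powr_mono2)
  also have "\<dots> \<le> \<Delta> 0" using amin_le_Delta_0 g0 eps by fastforce
  finally show ?case .
next
  case (Suc k)
  define H where "H = (1 + M) powr \<beta> / psi \<beta> L M"
  have IH: "amin * \<epsilon> powr (1 - \<alpha>) * H \<le> \<Delta> k"
    unfolding H_def by (rule Suc.IH) (use Suc.prems in auto)
  define \<nu> b where "\<nu> = norm (g (x k))" and "b = matnorm (B k)"
  have \<nu>: "\<nu> > \<epsilon>" using Suc.prems(1)[of k] by (simp add: \<nu>_def)
  have g: "g (x k) \<noteq> 0" using \<nu> eps by (auto simp: \<nu>_def)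
  have b: "0 \<le> b" "b \<le> M" using matnorm_nonneg Suc.prems(2)[of k] by (auto simp: b_def)
  have Hpos: "H \<ge> 0" unfolding H_def using psi_pos[OF L_ge_1, of M \<beta>] b by simp
  have HB: "H \<le> (1 + b) powr \<beta> / (L + b)"
    unfolding H_def using psi_quotient_bound[OF L_ge_1 beta b] .
  show ?case
  proof (cases "ratio k \<ge> \<eta>\<^sub>2")
    case True
    thus ?thesis using Delta_Suc_ge_very_successful[OF Delta_pos True] IH unfolding H_def by linarith
  next
    case False
    define c where "c = 2 * \<kappa>\<^sub>m\<^sub>d\<^sub>c * (1 - \<eta>\<^sub>2)"
    have c: "c \<ge> 0" using kappa_mdc eta by (simp add: c_def)
    have "c * \<nu> / (L + b) < \<nu> powr \<alpha> / (1 + b) powr \<beta> * \<Delta> k"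
      using very_successful_if_radius_small[OF g] False
      unfolding radius_eq[OF g] \<nu>_def b_def c_def by (metis not_le)
    moreover have P: "\<nu> powr \<alpha> > 0" "(1 + b) powr \<beta> > 0" "L + b > 0"
      using \<nu> eps b L_ge_1 by auto
    moreover have "\<nu> powr (1 - \<alpha>) = \<nu> / \<nu> powr \<alpha>" using \<nu> eps by (simp add: powr_diff)
    ultimately have D: "c * \<nu> powr (1 - \<alpha>) * ((1 + b) powr \<beta> / (L + b)) \<le> \<Delta> k"
      by (simp add: pos_divide_less_eq pos_le_divide_eq pos_less_divide_eq pos_divide_le_eq mult_ac)
    have "amin * (\<epsilon> powr (1 - \<alpha>) * H) \<le> (\<gamma>\<^sub>1 * c) * (\<nu> powr (1 - \<alpha>) * ((1 + b) powr \<beta> / (L + b)))"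
      using amin_le amin_pos HB Hpos \<nu> eps alpha gamma c unfolding c_def[symmetric]
      by (intro mult_mono powr_mono2) auto
    also have "\<dots> = \<gamma>\<^sub>1 * (c * \<nu> powr (1 - \<alpha>) * ((1 + b) powr \<beta> / (L + b)))"
      by (simp add: mult_ac)
    also have "\<dots> \<le> \<gamma>\<^sub>1 * \<Delta> k" by (intro mult_left_mono D) (use gamma in simp)
    also have "\<dots> \<le> \<Delta> (Suc k)" by (rule Delta_Suc_ge[OF Delta_pos])
    finally show ?thesis unfolding H_def by (simp add: mult_ac)
  qed
qed

text \<open>An accepted step realises the fraction \<open>\<eta>\<^sub>1\<close> of the model decrease. In the product of the
  gradient norm and the radius the exponents \<open>1 + \<alpha>\<close> and \<open>1 - \<alpha>\<close> of \<open>\<epsilon>\<close> add up to \<open>2\<close>, and the factor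
  \<open>(1 + M) powr \<beta>\<close> from \<open>Delta_ge\<close> cancels the damping of the radius by the Hessian.\<close>

lemma successful_decrease_ge:
  assumes eps: "\<epsilon> > 0" and large: "\<And>j. j \<le> k \<Longrightarrow> \<epsilon> < norm (g (x j))"
    and M: "\<And>j. j \<le> k \<Longrightarrow> matnorm (B j) \<le> M"
    and succ: "ratio k \<ge> \<eta>\<^sub>1"
  shows "\<eta>\<^sub>1 * \<kappa>\<^sub>m\<^sub>d\<^sub>c * amin * \<epsilon>\<^sup>2 / psi \<beta> L M \<le> f (x k) - f (x (Suc k))"
proof -
  define \<nu> b \<psi> where "\<nu> = norm (g (x k))" and "b = matnorm (B k)" and "\<psi> = psi \<beta> L M"
  have \<nu>: "\<nu> > \<epsilon>" using large[of k] by (simp add: \<nu>_def)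
  have g: "g (x k) \<noteq> 0" using \<nu> eps by (auto simp: \<nu>_def)
  have b: "0 \<le> b" "b \<le> M" using matnorm_nonneg M[of k] by (auto simp: b_def)
  have \<psi>: "\<psi> > 0" "L + b \<le> \<psi>"
    using psi_pos[OF L_ge_1, of M \<beta>] psi_ge[OF L_ge_1, of M \<beta>] b by (auto simp: \<psi>_def)
  have "amin * \<epsilon>\<^sup>2 / \<psi> \<le> \<nu> * radius k"
  proof -
    have "\<epsilon> powr (1 - \<alpha>) * \<epsilon> powr (1 + \<alpha>) = \<epsilon>\<^sup>2"
      using eps by (simp add: powr_add[symmetric])
    hence "amin * \<epsilon>\<^sup>2 / \<psi> = \<epsilon> powr (1 + \<alpha>) / (1 + M) powr \<beta>
        * (amin * \<epsilon> powr (1 - \<alpha>) * ((1 + M) powr \<beta> / \<psi>))"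
      using b by (simp add: field_simps)
    also have "\<dots> \<le> \<epsilon> powr (1 + \<alpha>) / (1 + M) powr \<beta> * \<Delta> k"
      unfolding \<psi>_def by (intro mult_left_mono Delta_ge eps large M) auto
    also have "\<dots> \<le> \<nu> powr (1 + \<alpha>) / (1 + b) powr \<beta> * \<Delta> k"
      using \<nu> eps alpha b beta Delta_pos[of k]
      by (intro mult_right_mono frac_le powr_mono2) auto
    also have "\<dots> = \<nu> * radius k"
      unfolding radius_eq[OF g] \<nu>_def[symmetric] b_def[symmetric]
      using \<nu> eps by (simp add: powr_add)
    finally show ?thesis .
  qed
  moreover have "amin * \<epsilon>\<^sup>2 / \<psi> \<le> \<nu> * (\<nu> / (L + b))"
  proof -
    have "amin * \<epsilon>\<^sup>2 \<le> 1 * \<nu>\<^sup>2"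
      using amin_le_1 \<nu> eps by (intro mult_mono power_mono) auto
    hence "amin * \<epsilon>\<^sup>2 / \<psi> \<le> \<nu>\<^sup>2 / (L + b)"
      using \<psi> b L_ge_1 by (intro frac_le) auto
    thus ?thesis by (simp add: power2_eq_square)
  qed
  ultimately have "amin * \<epsilon>\<^sup>2 / \<psi> \<le> \<nu> * min (radius k) (\<nu> / (L + b))"
    by (simp add: min_def)
  from mult_left_mono[OF this, of \<kappa>\<^sub>m\<^sub>d\<^sub>c]
  have dec: "\<kappa>\<^sub>m\<^sub>d\<^sub>c * (amin * \<epsilon>\<^sup>2 / \<psi>) \<le> model_decrease k"
    using model_decrease_ge[of k] kappa_mdc unfolding \<nu>_def b_def by (simp add: mult.assoc)
  moreover have "\<kappa>\<^sub>m\<^sub>d\<^sub>c * (amin * \<epsilon>\<^sup>2 / \<psi>) > 0" using kappa_mdc amin_pos eps \<psi> by simp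
  ultimately have "\<eta>\<^sub>1 * model_decrease k \<le> f (x k) - f (x k + s k)"
    using succ unfolding tr_ratio_def by (subst (asm) pos_le_divide_eq) auto
  moreover have "\<eta>\<^sub>1 * (\<kappa>\<^sub>m\<^sub>d\<^sub>c * (amin * \<epsilon>\<^sup>2 / \<psi>)) \<le> \<eta>\<^sub>1 * model_decrease k"
    using dec eta by (intro mult_left_mono) auto
  ultimately show ?thesis using iterate_Suc[of k] succ by (simp add: \<psi>_def mult.assoc)
qed

abbreviation successes_before :: "nat \<Rightarrow> nat" where
  "successes_before k \<equiv> card {i \<in> successful f g \<eta>\<^sub>1 x s B. i < k}"

lemma successes_before_Suc:
  "successes_before (Suc k) = (if ratio k \<ge> \<eta>\<^sub>1 then Suc (successes_before k) else successes_before k)"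
proof -
  have "{i \<in> successful f g \<eta>\<^sub>1 x s B. i < Suc k}
      = (if ratio k \<ge> \<eta>\<^sub>1 then insert k {i \<in> successful f g \<eta>\<^sub>1 x s B. i < k}
         else {i \<in> successful f g \<eta>\<^sub>1 x s B. i < k})"
    by (auto simp: successful_def less_Suc_eq)
  thus ?thesis by simp
qed

text \<open>Telescoping; the iterates do not move in unsuccessful iterations, so the successes alone are
  counted, the \<open>j\<close>-th of them being preceded by exactly \<open>j\<close> others when counted from \<open>0\<close>.\<close>

lemma sum_successes_le:
  assumes "\<And>k. \<lbrakk>k < N; ratio k \<ge> \<eta>\<^sub>1\<rbrakk> \<Longrightarrow> w (successes_before k) \<le> f (x k) - f (x (Suc k))"
  shows "(\<Sum>j<successes_before N. w j) \<le> f (x 0) - f (x N)"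
  using assms
proof (induction N)
  case (Suc N)
  have IH: "(\<Sum>j<successes_before N. w j) \<le> f (x 0) - f (x N)"
    using Suc by simp
  show ?case
  proof (cases "ratio N \<ge> \<eta>\<^sub>1")
    case True
    thus ?thesis using IH Suc.prems[of N] by (simp add: successes_before_Suc)
  next
    case False
    thus ?thesis using IH iterate_Suc[of N] by (simp add: successes_before_Suc)
  qed
qed simp

text \<open>The central estimate: the right side is \<open>\<kappa>\<^sub>1 / \<epsilon>\<^sup>2\<close>. It is stated for an arbitrary initial stretch of
  iterations with large gradients, so that it yields both the count up to the first small gradient and
  the existence of a small gradient.\<close>

lemma hessian_sum_successes_le:
  assumes mu: "\<mu> > 0" and low: "\<And>k. f (x k) \<ge> f\<^sub>l\<^sub>o\<^sub>w"
    and growth: "\<And>k. Max ((\<lambda>j. matnorm (B j)) ` {0..k})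
           \<le> \<mu> * (1 + rpow (real (successes_before k)) p)"
    and eps: "\<epsilon> > 0" and large: "\<And>k. k < N \<Longrightarrow> \<epsilon> < norm (g (x k))"
  shows "hessian_sum \<beta> L \<mu> p (successes_before N)
     \<le> (f (x 0) - f\<^sub>l\<^sub>o\<^sub>w) * (psi \<beta> L (2 * \<mu>) / (\<eta>\<^sub>1 * \<kappa>\<^sub>m\<^sub>d\<^sub>c * amin)) / \<epsilon>\<^sup>2"
proof -
  define c where "c = \<eta>\<^sub>1 * \<kappa>\<^sub>m\<^sub>d\<^sub>c * amin * \<epsilon>\<^sup>2"
  define \<psi> where "\<psi> j = psi \<beta> L (\<mu> * (1 + rpow (real j) p))" for j
  define P where "P = psi \<beta> L (2 * \<mu>)"
  have c: "c > 0" using eta kappa_mdc amin_pos eps by (simp add: c_def)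
  have P: "P > 0" unfolding P_def using L_ge_1 mu by (intro psi_pos) auto
  have B_le: "matnorm (B j) \<le> \<mu> * (1 + rpow (real (successes_before k)) p)" if "j \<le> k" for j k
  proof -
    have "matnorm (B j) \<le> Max ((\<lambda>j. matnorm (B j)) ` {0..k})"
      using that by (intro Max_ge) auto
    thus ?thesis using growth[of k] by linarith
  qed
  have "(\<Sum>j<successes_before N. c / \<psi> j) \<le> f (x 0) - f (x N)"
  proof (rule sum_successes_le)
    fix k assume "k < N" "ratio k \<ge> \<eta>\<^sub>1"
    thus "c / \<psi> (successes_before k) \<le> f (x k) - f (x (Suc k))"
      unfolding c_def \<psi>_def using eps B_le large by (intro successful_decrease_ge) auto
  qed
  also have "\<dots> \<le> f (x 0) - f\<^sub>l\<^sub>o\<^sub>w" using low[of N] by simp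
  finally have "P / c * (\<Sum>j<successes_before N. c / \<psi> j) \<le> P / c * (f (x 0) - f\<^sub>l\<^sub>o\<^sub>w)"
    using P c by (intro mult_left_mono) auto
  also have "P / c * (\<Sum>j<successes_before N. c / \<psi> j) = hessian_sum \<beta> L \<mu> p (successes_before N)"
    using c by (simp add: hessian_sum_def sum_distrib_left P_def \<psi>_def)
  finally show ?thesis by (simp add: c_def P_def mult_ac)
qed

end

section \<open>The evaluation bounds\<close>

lemma count_below_unbounded:
  assumes "infinite (S :: nat set)"
  shows "\<exists>N. real (card {i \<in> S. i < N}) > b"
proof -
  obtain T where T: "T \<subseteq> S" "finite T" "card T = Suc (nat \<lceil>b\<rceil>)"
    using infinite_arbitrarily_large[OF assms] by blast
  then obtain N where "\<forall>i\<in>T. i < N" using finite_nat_set_iff_bounded by blast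
  hence "T \<subseteq> {i \<in> S. i < N}" using T by auto
  hence "card T \<le> card {i \<in> S. i < N}" by (intro card_mono) auto
  thus ?thesis using T by (intro exI[of _ N]) linarith
qed

theorem theorem2:
  fixes f :: "real^'n \<Rightarrow> real" and g :: "real^'n \<Rightarrow> real^'n"
    and \<eta>\<^sub>1 \<eta>\<^sub>2 \<gamma>\<^sub>1 \<gamma>\<^sub>2 \<gamma>\<^sub>3 \<gamma>\<^sub>4 \<kappa>\<^sub>m\<^sub>d\<^sub>c \<alpha> \<beta> :: real
    and x s :: "nat \<Rightarrow> real^'n" and B :: "nat \<Rightarrow> real^'n^'n" and \<Delta> t :: "nat \<Rightarrow> real"
    and f\<^sub>l\<^sub>o\<^sub>w L \<mu> p \<kappa>\<^sub>0 \<kappa>\<^sub>1 \<kappa>\<^sub>2 :: real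
  assumes gradient: "\<And>y. GDERIV f y :> g y"
    and gradient_continuous: "continuous_on UNIV g"
    and bounded_below: "\<And>y. f y \<ge> f\<^sub>l\<^sub>o\<^sub>w"
    and run: "trust_region_run f g \<eta>\<^sub>1 \<eta>\<^sub>2 \<gamma>\<^sub>1 \<gamma>\<^sub>2 \<gamma>\<^sub>3 \<gamma>\<^sub>4 \<kappa>\<^sub>m\<^sub>d\<^sub>c \<alpha> \<beta> x s B \<Delta> t"
    and L_ge_1: "L \<ge> 1"
    and model_error: "\<And>k. \<bar>f (x k + s k) - tr_model f g (x k) (B k) (s k)\<bar>
                         \<le> 1/2 * (L + matnorm (B k)) * (norm (s k))\<^sup>2"
    and mu_pos: "\<mu> > 0"
    and p_range: "0 \<le> p" "p \<le> 1"
    and hessian_growth: "\<And>k. Max ((\<lambda>j. matnorm (B j)) ` {0..k})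
           \<le> \<mu> * (1 + rpow (real (card {i \<in> successful f g \<eta>\<^sub>1 x s B. i < k})) p)"
    and infinitely_many_successful: "infinite (successful f g \<eta>\<^sub>1 x s B)"
    and iterates_bounded_below: "\<And>k. f (x k) \<ge> f\<^sub>l\<^sub>o\<^sub>w"
    and kappa_0: "\<kappa>\<^sub>0 = psi \<beta> L (2 * \<mu>) /
                     (\<eta>\<^sub>1 * \<kappa>\<^sub>m\<^sub>d\<^sub>c * a_min \<gamma>\<^sub>1 \<kappa>\<^sub>m\<^sub>d\<^sub>c \<eta>\<^sub>2 \<alpha> (\<Delta> 0) (norm (g (x 0))))"
    and kappa_1: "\<kappa>\<^sub>1 = (f (x 0) - f\<^sub>l\<^sub>o\<^sub>w) * \<kappa>\<^sub>0"
    and kappa_2: "\<kappa>\<^sub>2 = psi \<beta> L (2 * \<mu>) / psi \<beta> L \<mu>"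
  shows "\<kappa>\<^sub>0 > 0 \<and> \<kappa>\<^sub>1 \<ge> 0 \<and> \<kappa>\<^sub>2 > 0 \<and>
    (\<forall>\<epsilon>>0. \<exists>k. norm (g (x k)) \<le> \<epsilon>) \<and>
    (p = 0 \<longrightarrow>
       (\<forall>\<epsilon>>0. real (card (successful_before f g \<eta>\<^sub>1 x s B \<epsilon>)) \<le> \<kappa>\<^sub>1 / \<epsilon>\<^sup>2) \<and>
       (\<lambda>\<epsilon>. \<kappa>\<^sub>1 / \<epsilon>\<^sup>2) \<in> O[at_right 0](\<lambda>\<epsilon>. 1 / \<epsilon>\<^sup>2)) \<and>
    (0 < p \<and> p < 1 \<longrightarrow>
       (\<forall>\<epsilon>>0. real (card (successful_before f g \<eta>\<^sub>1 x s B \<epsilon>))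
                 \<le> ((1 - p) * (\<kappa>\<^sub>1 / \<epsilon>\<^sup>2 - \<kappa>\<^sub>2) + 1) powr (1 / (1 - p))) \<and>
       (\<lambda>\<epsilon>. ((1 - p) * (\<kappa>\<^sub>1 / \<epsilon>\<^sup>2 - \<kappa>\<^sub>2) + 1) powr (1 / (1 - p)))
          \<in> O[at_right 0](\<lambda>\<epsilon>. ((1 - p) * (1 / \<epsilon>\<^sup>2)) powr (1 / (1 - p)))) \<and>
    (p = 1 \<longrightarrow>
       (\<forall>\<epsilon>>0. real (card (successful_before f g \<eta>\<^sub>1 x s B \<epsilon>)) \<le> exp (\<kappa>\<^sub>1 / \<epsilon>\<^sup>2 - \<kappa>\<^sub>2)))"
proof -
  interpret accurate_trust_region_run f g \<eta>\<^sub>1 \<eta>\<^sub>2 \<gamma>\<^sub>1 \<gamma>\<^sub>2 \<gamma>\<^sub>3 \<gamma>\<^sub>4 \<kappa>\<^sub>m\<^sub>d\<^sub>c \<alpha> \<beta> x s B \<Delta> t L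
    using run L_ge_1 model_error
    by (intro accurate_trust_region_run.intro accurate_trust_region_run_axioms.intro)
  have k0: "\<kappa>\<^sub>0 > 0"
    unfolding kappa_0 using psi_pos[OF L_ge_1, of "2 * \<mu>" \<beta>] mu_pos eta kappa_mdc amin_pos by simp
  have k1: "\<kappa>\<^sub>1 \<ge> 0" unfolding kappa_1 using k0 iterates_bounded_below[of 0] by simp
  have k2: "\<kappa>\<^sub>2 > 0"
    unfolding kappa_2
    using psi_pos[OF L_ge_1, of "2 * \<mu>" \<beta>] psi_pos[OF L_ge_1, of \<mu> \<beta>] mu_pos by simp
  have sum_le: "hessian_sum \<beta> L \<mu> p (successes_before N) \<le> \<kappa>\<^sub>1 / \<epsilon>\<^sup>2"
    if "\<epsilon> > 0" "\<And>k. k < N \<Longrightarrow> \<epsilon> < norm (g (x k))" for \<epsilon> N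
    unfolding kappa_1 kappa_0
    using mu_pos iterates_bounded_below hessian_growth that by (rule hessian_sum_successes_le)
  have conv: "\<exists>k. norm (g (x k)) \<le> \<epsilon>" if e: "\<epsilon> > 0" for \<epsilon>
  proof (rule ccontr)
    assume "\<nexists>k. norm (g (x k)) \<le> \<epsilon>"
    \<comment> \<open>The evaluation bound then holds for all \<open>N\<close> and limits the total number of successes.\<close>
    hence le: "hessian_sum \<beta> L \<mu> p (successes_before N) \<le> \<kappa>\<^sub>1 / \<epsilon>\<^sup>2" for N
      using e by (intro sum_le) (auto simp: not_le)
    have "\<exists>b. \<forall>N. real (successes_before N) \<le> b"
    proof -
      consider "p = 0" | "0 < p" "p < 1" | "p = 1" using p_range by linarith
      thus ?thesis
      proof cases
        case 1
        thus ?thesis using le hessian_sum_0[OF L_ge_1 mu_pos] by auto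
      next
        case 2
        thus ?thesis using count_bound_powr[OF L_ge_1 mu_pos _ _ le] by blast
      next
        case 3
        thus ?thesis using count_bound_exp[OF L_ge_1 mu_pos] le by blast
      qed
    qed
    thus False using count_below_unbounded[OF infinitely_many_successful] by (meson not_le)
  qed
  \<comment> \<open>By minimality, all gradients before the first small one are larger than \<open>\<epsilon>\<close>.\<close>
  have bound: "hessian_sum \<beta> L \<mu> p (card (successful_before f g \<eta>\<^sub>1 x s B \<epsilon>)) \<le> \<kappa>\<^sub>1 / \<epsilon>\<^sup>2"
    if "\<epsilon> > 0" for \<epsilon>
    unfolding successful_before_def first_iter_def
    using that not_less_Least[of _ "\<lambda>k. norm (g (x k)) \<le> \<epsilon>"] by (intro sum_le) (auto simp: not_le)
  have case0: "real (card (successful_before f g \<eta>\<^sub>1 x s B \<epsilon>)) \<le> \<kappa>\<^sub>1 / \<epsilon>\<^sup>2"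
    if "p = 0" "\<epsilon> > 0" for \<epsilon>
    using bound[OF that(2)] hessian_sum_0[OF L_ge_1 mu_pos] that(1) by simp
  have bigo0: "(\<lambda>\<epsilon>. \<kappa>\<^sub>1 / \<epsilon>\<^sup>2) \<in> O[at_right 0](\<lambda>\<epsilon>. 1 / \<epsilon>\<^sup>2)"
    by (rule bigoI[of _ "\<kappa>\<^sub>1"]) (use k1 in simp)
  have casep: "real (card (successful_before f g \<eta>\<^sub>1 x s B \<epsilon>))
      \<le> ((1 - p) * (\<kappa>\<^sub>1 / \<epsilon>\<^sup>2 - \<kappa>\<^sub>2) + 1) powr (1 / (1 - p))"
    if "0 < p" "p < 1" "\<epsilon> > 0" for \<epsilon>
    unfolding kappa_2 using count_bound_powr[OF L_ge_1 mu_pos that(1,2) bound[OF that(3)]] .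
  have bigop: "(\<lambda>\<epsilon>. ((1 - p) * (\<kappa>\<^sub>1 / \<epsilon>\<^sup>2 - \<kappa>\<^sub>2) + 1) powr (1 / (1 - p)))
      \<in> O[at_right 0](\<lambda>\<epsilon>. ((1 - p) * (1 / \<epsilon>\<^sup>2)) powr (1 / (1 - p)))" if "p < 1"
    using k1 that by (intro powr_bound_bigo) auto
  have case1: "real (card (successful_before f g \<eta>\<^sub>1 x s B \<epsilon>)) \<le> exp (\<kappa>\<^sub>1 / \<epsilon>\<^sup>2 - \<kappa>\<^sub>2)"
    if "p = 1" "\<epsilon> > 0" for \<epsilon>
    unfolding kappa_2 using count_bound_exp[OF L_ge_1 mu_pos] bound[OF that(2)] that(1) by blast
  show ?thesis
    using k0 k1 k2 conv case0 bigo0 casep bigop case1 by blast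
qed

end
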